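(* Let $L$ be a computable (decidable) set of strings over a finite alphabet. Then there is an $\mathrm{ASP^{fs}}$ program $\mathcal{P}$, with a 4-ary predicate $\mathrm{conf}$, a constant $s_i$, a constant for each alphabet symbol, and a constant $\sqcup$, such that for every string $x=x_1\cdots x_n$, the query $\mathcal{Q}_x$ defined as $\mathrm{conf}(s_i,[\,],x_1,[x_2,\dots,x_n])$ if $n>0$ and as $\mathrm{conf}(s_i,[\,],\sqcup,[\,])$ if $n=0$ is finitely recursive on $\mathcal{P}$, and $\mathcal{P}$ cautiously entails $\mathcal{Q}_x$ iff $\mathcal{P}$ bravely entails $\mathcal{Q}_x$ iff $x\in L$.
   Context: Terms are variables or functional terms $f(t_1,\dots,t_k)$; lists are terms built from the constant $[\,]$ and a binary function symbol, with $[h|t]$ denoting the list with head $h$ and tail $t$ and $[a_1,\dots,a_k]$ the usual abbreviation. A rule $r$: $a_1 \vee \dots \vee a_n \leftarrow b_1,\dots,b_j,\mathrm{not}\,b_{j+1},\dots,\mathrm{not}\,b_m$; $H(r)$, $B^+(r)$, $B^-(r)$ are head, positive body, negative body atoms, $\mathrm{atoms}(r)$ their union. A program is a finite set of rules; an $\mathrm{ASP^{fs}}$ program is a stratified one (no cycle of predicate dependencies through negation), disjunction and function symbols allowed. $\mathrm{Ground}(\mathcal{P})$ is the set of ground instances over the ground terms of $\mathcal{P}$'s function symbols; stable models are the subset-minimal models $M$ of the reduct $\mathrm{Ground}(\mathcal{P})^M$ (delete ground rules with $B^-\cap M\neq\emptyset$, drop negative literals). A query is a ground atom; cautious (brave)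 entailment: it is in every (some) stable model. Relevant atoms for $\mathcal{Q}$: $\mathcal{Q}$ and all atoms of $\mathrm{atoms}(r_g)$, $r_g\in\mathrm{Ground}(\mathcal{P})$, with a relevant head atom; $\mathcal{Q}$ is finitely recursive on $\mathcal{P}$ if finitely many ground atoms are relevant. A set $L$ is computable if some deterministic Turing machine halts on every input and accepts exactly the strings in $L$. *)

theory Defs imports Main begin

section \<open>Deterministic Turing machines\<close>

text \<open>One tape, infinite in both directions. The tape symbols are the blank, the letters of
  the input alphabet and arbitrarily many auxiliary symbols, of which a machine uses finitely many.\<close>

datatype 'a tape_symbol = Blank | Letter 'a | Aux nat

datatype move = Move_Left | Move_Right

record 'a tm =
  states :: "nat set"
  tape_alphabet :: "'a tape_symbol set"
  start :: nat
  accepting :: "nat set"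
  delta :: "nat \<Rightarrow> 'a tape_symbol \<Rightarrow> (nat \<times> 'a tape_symbol \<times> move) option"

definition turing_machine :: "'a set \<Rightarrow> 'a tm \<Rightarrow> bool" where
  "turing_machine \<Sigma> M \<longleftrightarrow>
     finite (states M) \<and> finite (tape_alphabet M) \<and>
     start M \<in> states M \<and> accepting M \<subseteq> states M \<and>
     Blank \<in> tape_alphabet M \<and> Letter ` \<Sigma> \<subseteq> tape_alphabet M \<and>
     (\<forall>q\<in>states M. \<forall>a\<in>tape_alphabet M. \<forall>q' b d.
        delta M q a = Some (q', b, d) \<longrightarrow> q' \<in> states M \<and> b \<in> tape_alphabet M)"

text \<open>A configuration consists of the state, the tape contents and the head position.\<close>

type_synonym 'a config = "nat \<times> (int \<Rightarrow> 'a tape_symbol) \<times> int"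

fun move_head :: "move \<Rightarrow> int \<Rightarrow> int" where
  "move_head Move_Left h = h - 1"
| "move_head Move_Right h = h + 1"

text \<open>The machine halts exactly when \<^const>\<open>delta\<close> is undefined (\<^const>\<open>None\<close>).\<close>

fun tm_step :: "'a tm \<Rightarrow> 'a config \<Rightarrow> 'a config option" where
  "tm_step M (q, tape, h) =
     (case delta M q (tape h) of
        None \<Rightarrow> None
      | Some (q', b, d) \<Rightarrow> Some (q', tape(h := b), move_head d h))"

definition initial_config :: "'a tm \<Rightarrow> 'a list \<Rightarrow> 'a config" where
  "initial_config M x =
     (start M, \<lambda>i. if 0 \<le> i \<and> i < int (length x) then Letter (x ! nat i) else Blank, 0)"

definition halts_in :: "'a tm \<Rightarrow> 'a list \<Rightarrow> 'a config \<Rightarrow> bool" where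
  "halts_in M x c \<longleftrightarrow>
     (\<lambda>c c'. tm_step M c = Some c')\<^sup>*\<^sup>* (initial_config M x) c \<and> tm_step M c = None"

definition tm_halts :: "'a tm \<Rightarrow> 'a list \<Rightarrow> bool" where
  "tm_halts M x \<longleftrightarrow> (\<exists>c. halts_in M x c)"

definition tm_accepts :: "'a tm \<Rightarrow> 'a list \<Rightarrow> bool" where
  "tm_accepts M x \<longleftrightarrow> (\<exists>q tape h. halts_in M x (q, tape, h) \<and> q \<in> accepting M)"

definition computable_language :: "'a set \<Rightarrow> 'a list set \<Rightarrow> bool" where
  "computable_language \<Sigma> L \<longleftrightarrow>
     L \<subseteq> lists \<Sigma> \<and>
     (\<exists>M. turing_machine \<Sigma> M \<and>
        (\<forall>x\<in>lists \<Sigma>. tm_halts M x \<and> (tm_accepts M x \<longleftrightarrow> x \<in> L)))"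


section \<open>Disjunctive logic programs with function symbols\<close>

datatype trm = Var nat | Fun string "trm list"

datatype atom = Atom string "trm list"

datatype asp_rule = Rule (head: "atom list") (pos: "atom list") (neg: "atom list")

abbreviation H :: "asp_rule \<Rightarrow> atom set" where "H r \<equiv> set (head r)"
abbreviation Bpos :: "asp_rule \<Rightarrow> atom set" where "Bpos r \<equiv> set (pos r)"
abbreviation Bneg :: "asp_rule \<Rightarrow> atom set" where "Bneg r \<equiv> set (neg r)"

definition atoms :: "asp_rule \<Rightarrow> atom set" where
  "atoms r = H r \<union> Bpos r \<union> Bneg r"

text \<open>Function and predicate symbols are identified by name and arity; a constant is a
  function symbol of arity 0.\<close>

primrec trm_vars :: "trm \<Rightarrow> nat set" where
  "trm_vars (Var v) = {v}"
| "trm_vars (Fun f ts) = \<Union> (set (map trm_vars ts))"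

primrec trm_funs :: "trm \<Rightarrow> (string \<times> nat) set" where
  "trm_funs (Var v) = {}"
| "trm_funs (Fun f ts) = insert (f, length ts) (\<Union> (set (map trm_funs ts)))"

fun atom_vars :: "atom \<Rightarrow> nat set" where
  "atom_vars (Atom p ts) = \<Union> (trm_vars ` set ts)"

fun atom_funs :: "atom \<Rightarrow> (string \<times> nat) set" where
  "atom_funs (Atom p ts) = \<Union> (trm_funs ` set ts)"

fun atom_pred :: "atom \<Rightarrow> string \<times> nat" where
  "atom_pred (Atom p ts) = (p, length ts)"

definition rule_vars :: "asp_rule \<Rightarrow> nat set" where
  "rule_vars r = \<Union> (atom_vars ` atoms r)"

definition funs :: "asp_rule set \<Rightarrow> (string \<times> nat) set" where
  "funs P = (\<Union>r\<in>P. \<Union> (atom_funs ` atoms r))"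

definition preds :: "asp_rule set \<Rightarrow> (string \<times> nat) set" where
  "preds P = (\<Union>r\<in>P. atom_pred ` atoms r)"


subsection \<open>Stratified programs\<close>

text \<open>A head predicate depends on every body predicate of its rule and, as is usual for
  stratification in the presence of disjunction, on the other predicates of the same head.\<close>

definition depends :: "asp_rule set \<Rightarrow> ((string \<times> nat) \<times> (string \<times> nat)) set" where
  "depends P = {(p, q). \<exists>r\<in>P. p \<in> atom_pred ` H r \<and> q \<in> atom_pred ` atoms r}"

definition neg_depends :: "asp_rule set \<Rightarrow> ((string \<times> nat) \<times> (string \<times> nat)) set" where
  "neg_depends P = {(p, q). \<exists>r\<in>P. p \<in> atom_pred ` H r \<and> q \<in> atom_pred ` Bneg r}"

definition stratified :: "asp_rule set \<Rightarrow> bool" where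
  "stratified P \<longleftrightarrow> (\<forall>(p, q)\<in>neg_depends P. (q, p) \<notin> (depends P)\<^sup>*)"

definition asp_fs_program :: "asp_rule set \<Rightarrow> bool" where
  "asp_fs_program P \<longleftrightarrow> finite P \<and> (\<forall>r\<in>P. head r \<noteq> []) \<and> stratified P"


subsection \<open>Grounding\<close>

inductive_set ground_terms :: "(string \<times> nat) set \<Rightarrow> trm set"
  for F :: "(string \<times> nat) set" where
  "(f, length ts) \<in> F \<Longrightarrow> (\<And>t. t \<in> set ts \<Longrightarrow> t \<in> ground_terms F) \<Longrightarrow> Fun f ts \<in> ground_terms F"

definition herbrand_base :: "asp_rule set \<Rightarrow> atom set" where
  "herbrand_base P =
     {Atom p ts | p ts. (p, length ts) \<in> preds P \<and> set ts \<subseteq> ground_terms (funs P)}"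

primrec subst_trm :: "(nat \<Rightarrow> trm) \<Rightarrow> trm \<Rightarrow> trm" where
  "subst_trm \<sigma> (Var v) = \<sigma> v"
| "subst_trm \<sigma> (Fun f ts) = Fun f (map (subst_trm \<sigma>) ts)"

fun subst_atom :: "(nat \<Rightarrow> trm) \<Rightarrow> atom \<Rightarrow> atom" where
  "subst_atom \<sigma> (Atom p ts) = Atom p (map (subst_trm \<sigma>) ts)"

definition subst_rule :: "(nat \<Rightarrow> trm) \<Rightarrow> asp_rule \<Rightarrow> asp_rule" where
  "subst_rule \<sigma> r =
     Rule (map (subst_atom \<sigma>) (head r)) (map (subst_atom \<sigma>) (pos r)) (map (subst_atom \<sigma>) (neg r))"

definition Ground :: "asp_rule set \<Rightarrow> asp_rule set" where
  "Ground P =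
     {subst_rule \<sigma> r | \<sigma> r. r \<in> P \<and> (\<forall>v\<in>rule_vars r. \<sigma> v \<in> ground_terms (funs P))}"


subsection \<open>Stable models and entailment\<close>

definition is_model :: "asp_rule set \<Rightarrow> atom set \<Rightarrow> bool" where
  "is_model G I \<longleftrightarrow> (\<forall>r\<in>G. Bpos r \<subseteq> I \<and> Bneg r \<inter> I = {} \<longrightarrow> H r \<inter> I \<noteq> {})"

definition reduct :: "asp_rule set \<Rightarrow> atom set \<Rightarrow> asp_rule set" where
  "reduct G M = {Rule (head r) (pos r) [] | r. r \<in> G \<and> Bneg r \<inter> M = {}}"

definition stable_model :: "asp_rule set \<Rightarrow> atom set \<Rightarrow> bool" where
  "stable_model P M \<longleftrightarrow>
     M \<subseteq> herbrand_base P \<and>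
     is_model (reduct (Ground P) M) M \<and>
     (\<forall>N. N \<subset> M \<longrightarrow> \<not> is_model (reduct (Ground P) M) N)"

definition cautiously_entails :: "asp_rule set \<Rightarrow> atom \<Rightarrow> bool" where
  "cautiously_entails P Q \<longleftrightarrow> (\<forall>M. stable_model P M \<longrightarrow> Q \<in> M)"

definition bravely_entails :: "asp_rule set \<Rightarrow> atom \<Rightarrow> bool" where
  "bravely_entails P Q \<longleftrightarrow> (\<exists>M. stable_model P M \<and> Q \<in> M)"


subsection \<open>Finitely recursive queries\<close>

inductive_set relevant :: "asp_rule set \<Rightarrow> atom \<Rightarrow> atom set"
  for P :: "asp_rule set" and Q :: atom where
  query: "Q \<in> relevant P Q"
| rule_atom: "a \<in> relevant P Q \<Longrightarrow> r \<in> Ground P \<Longrightarrow> a \<in> H r \<Longrightarrow> b \<in> atoms r \<Longrightarrow> b \<in> relevant P Q"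

definition finitely_recursive :: "asp_rule set \<Rightarrow> atom \<Rightarrow> bool" where
  "finitely_recursive P Q \<longleftrightarrow> finite (relevant P Q)"


subsection \<open>List terms and the queries for input strings\<close>

abbreviation const :: "string \<Rightarrow> trm" where
  "const c \<equiv> Fun c []"

definition nil_name :: string where "nil_name = ''[]''"
definition cons_name :: string where "cons_name = ''[|]''"

primrec list_trm :: "trm list \<Rightarrow> trm" where
  "list_trm [] = const nil_name"
| "list_trm (t # ts) = Fun cons_name [t, list_trm ts]"

text \<open>The arguments are the names of the predicate, of the constant for the initial state, of the
  constants for the alphabet symbols, and of the constant for the blank.\<close>

fun conf_query :: "string \<Rightarrow> string \<Rightarrow> ('a \<Rightarrow> string) \<Rightarrow> string \<Rightarrow> 'a list \<Rightarrow> atom" where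
  "conf_query conf s_i letter blank [] =
     Atom conf [const s_i, list_trm [], const blank, list_trm []]"
| "conf_query conf s_i letter blank (a # x) =
     Atom conf [const s_i, list_trm [], const (letter a), list_trm (map (\<lambda>b. const (letter b)) x)]"

end

theory Submission imports Defs "HOL-Library.More_List" begin

text \<open>Configurations are coded by two lists (the tape left of the head, reversed, and the tape right
  of it) around the scanned symbol. The program runs the machine backwards: an atom for a
  configuration is derivable iff the atom for its successor is, and the accepting halting
  configurations are facts. The program is positive, so its only stable model is the least model;
  and because the machine is deterministic, at most one ground rule has a given configuration in its
  head, so the relevant atoms for the initial configuration are those of the run, which is finite.\<close>

section \<open>Positive programs with single heads\<close>

definition definite :: "asp_rule set \<Rightarrow> bool" where
  "definite P \<longleftrightarrow> (\<forall>r\<in>P. (\<exists>h. head r = [h]) \<and> neg r = [])"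

text \<open>For definite programs this is the least fixpoint of the immediate consequence operator;
  its induction rule supplies minimality.\<close>

inductive_set least_model :: "asp_rule set \<Rightarrow> atom set" for P :: "asp_rule set" where
  "r \<in> Ground P \<Longrightarrow> H r = {h} \<Longrightarrow> (\<And>b. b \<in> Bpos r \<Longrightarrow> b \<in> least_model P) \<Longrightarrow> h \<in> least_model P"

lemma least_modelE:
  assumes "a \<in> least_model P"
  obtains r where "r \<in> Ground P" "H r = {a}" "Bpos r \<subseteq> least_model P"
  using assms
proof (cases rule: least_model.cases)
  case (1 r)
  then show ?thesis using that[of r] by auto
qed

lemma definite_Ground: "definite P \<Longrightarrow> definite (Ground P)"
  unfolding definite_def Ground_def subst_rule_def by fastforce

text \<open>Without negative literals no rule is deleted and none is shortened, so every candidate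
  \<open>M\<close> sees the same reduct.\<close>

lemma reduct_definite:
  assumes "definite G"
  shows "reduct G M = G"
proof -
  have "Rule (head r) (pos r) [] = r \<and> Bneg r \<inter> M = {}" if "r \<in> G" for r
    using assms that unfolding definite_def by (cases r) auto
  then show ?thesis unfolding reduct_def by force
qed

lemma subst_trm_ground:
  assumes "trm_funs t \<subseteq> F" "\<And>v. v \<in> trm_vars t \<Longrightarrow> \<sigma> v \<in> ground_terms F"
  shows "subst_trm \<sigma> t \<in> ground_terms F"
  using assms
proof (induction t)
  case (Fun f ts)
  show ?case
    unfolding subst_trm.simps
  proof (rule ground_terms.intros)
    show "(f, length (map (subst_trm \<sigma>) ts)) \<in> F" using Fun.prems by auto
    fix t assume "t \<in> set (map (subst_trm \<sigma>) ts)"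
    then show "t \<in> ground_terms F" using Fun by fastforce
  qed
qed auto

text \<open>Substitution keeps predicate and arity, and it inserts only ground terms. Needed because
  a stable model has to consist of Herbrand atoms.\<close>

lemma Ground_atoms_herbrand_base:
  assumes "r \<in> Ground P" "a \<in> atoms r"
  shows "a \<in> herbrand_base P"
proof -
  obtain \<sigma> r0 where r0: "r0 \<in> P" "r = subst_rule \<sigma> r0"
    and \<sigma>: "\<And>v. v \<in> rule_vars r0 \<Longrightarrow> \<sigma> v \<in> ground_terms (funs P)"
    using assms(1) unfolding Ground_def by auto
  obtain a0 where a0: "a0 \<in> atoms r0" "a = subst_atom \<sigma> a0"
    using assms(2) unfolding r0(2) atoms_def subst_rule_def by auto
  obtain p ts where p: "a0 = Atom p ts" by (cases a0)
  have "(p, length ts) \<in> preds P"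
    using r0(1) a0(1) p unfolding preds_def by force
  moreover have "subst_trm \<sigma> t \<in> ground_terms (funs P)" if "t \<in> set ts" for t
  proof (rule subst_trm_ground)
    have "atom_funs a0 \<subseteq> funs P" using r0(1) a0(1) unfolding funs_def by blast
    then show "trm_funs t \<subseteq> funs P" using that p by auto
    fix v assume "v \<in> trm_vars t"
    then have "v \<in> rule_vars r0" using that p a0(1) unfolding rule_vars_def by force
    then show "\<sigma> v \<in> ground_terms (funs P)" by (rule \<sigma>)
  qed
  ultimately show ?thesis unfolding herbrand_base_def a0(2) p by auto
qed

text \<open>The reduct no longer depends on \<open>M\<close>. The closure under ground rules is a
  model and, by induction on derivations, lies inside every model, so it is the only minimal
  one.\<close>

lemma stable_model_definite:
  assumes "definite P"
  shows "stable_model P M \<longleftrightarrow> M = least_model P"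
proof -
  have red: "reduct (Ground P) M = Ground P" for M
    using reduct_definite definite_Ground assms by blast
  have model: "is_model (Ground P) (least_model P)"
    unfolding is_model_def
  proof (intro ballI impI)
    fix r assume r: "r \<in> Ground P" and body: "Bpos r \<subseteq> least_model P \<and> Bneg r \<inter> least_model P = {}"
    obtain h where h: "H r = {h}"
      using definite_Ground[OF assms] r unfolding definite_def by fastforce
    with r body have "h \<in> least_model P" by (blast intro: least_model.intros)
    with h show "H r \<inter> least_model P \<noteq> {}" by simp
  qed
  have min: "least_model P \<subseteq> I" if I: "is_model (Ground P) I" for I
  proof
    fix a assume "a \<in> least_model P"
    then show "a \<in> I"
    proof (induction rule: least_model.induct)
      case (1 r h)
      have "Bneg r = {}" using definite_Ground[OF assms] 1(1) unfolding definite_def by fastforce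
      moreover have "Bpos r \<subseteq> I" using 1 by auto
      ultimately have "H r \<inter> I \<noteq> {}" using I \<open>r \<in> Ground P\<close> unfolding is_model_def by simp
      with \<open>H r = {h}\<close> show ?case by simp
    qed
  qed
  have base: "least_model P \<subseteq> herbrand_base P"
  proof
    fix a assume "a \<in> least_model P"
    then obtain r where "r \<in> Ground P" "H r = {a}" by (rule least_modelE)
    then show "a \<in> herbrand_base P" using Ground_atoms_herbrand_base[of r P a] by (simp add: atoms_def)
  qed
  show ?thesis
  proof
    assume "stable_model P M"
    then have "is_model (Ground P) M" "\<not> least_model P \<subset> M"
      unfolding stable_model_def red using model by blast+
    with min show "M = least_model P" by blast
  next
    assume "M = least_model P"
    with base model show "stable_model P M"
      unfolding stable_model_def red by (auto dest: min)
  qed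
qed

lemma entails_definite:
  assumes "definite P"
  shows "cautiously_entails P Q \<longleftrightarrow> Q \<in> least_model P"
    and "bravely_entails P Q \<longleftrightarrow> Q \<in> least_model P"
  unfolding cautiously_entails_def bravely_entails_def stable_model_definite[OF assms] by auto

text \<open>Empty negative bodies give no negative dependency edges, so stratification holds
  vacuously.\<close>

lemma asp_fs_program_definite:
  assumes "finite P" "definite P"
  shows "asp_fs_program P"
proof -
  have "neg_depends P = {}" using assms(2) unfolding neg_depends_def definite_def by fastforce
  then show ?thesis
    using assms unfolding asp_fs_program_def stratified_def definite_def by fastforce
qed

text \<open>The tool for finiteness proofs: it suffices to find a finite set that contains the query
  and is closed under passing from a head atom to its ground rule.\<close>

lemma relevant_subset:
  assumes "Q \<in> A"
    and "\<And>a r. a \<in> A \<Longrightarrow> r \<in> Ground P \<Longrightarrow> a \<in> H r \<Longrightarrow> atoms r \<subseteq> A"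
  shows "relevant P Q \<subseteq> A"
proof
  fix b assume "b \<in> relevant P Q"
  then show "b \<in> A" by induction (use assms in blast)+
qed

section \<open>Configurations as pairs of lists\<close>

type_synonym 'a list_config =
  "nat \<times> 'a tape_symbol list \<times> 'a tape_symbol \<times> 'a tape_symbol list"

text \<open>An exhausted list stands for an all-blank half tape, hence the value on
  \<open>[]\<close>.\<close>

fun scan :: "'a tape_symbol list \<Rightarrow> 'a tape_symbol" where
  "scan [] = Blank"
| "scan (a # _) = a"

text \<open>Moving beyond the end of a list agrees with the infinite tape, since
  \<open>scan [] = Blank\<close> and \<open>tl [] = []\<close>.\<close>

fun list_step :: "'a tm \<Rightarrow> 'a list_config \<Rightarrow> 'a list_config option" where
  "list_step M (q, l, v, r) =
     (case delta M q v of
        None \<Rightarrow> None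
      | Some (q', b, Move_Left) \<Rightarrow> Some (q', tl l, scan l, b # r)
      | Some (q', b, Move_Right) \<Rightarrow> Some (q', b # l, scan r, tl r))"

text \<open>Both lists run outward from the head. Neither side determines the other: trailing blanks
  in the lists and the absolute head position are free.\<close>

fun represents :: "'a list_config \<Rightarrow> 'a config \<Rightarrow> bool" where
  "represents (q, l, v, r) (q', tape, h) \<longleftrightarrow> q' = q \<and> tape h = v \<and>
     (\<forall>i. tape (h - 1 - int i) = nth_default Blank l i) \<and>
     (\<forall>i. tape (h + 1 + int i) = nth_default Blank r i)"

lemma nth_default_0_scan: "nth_default Blank xs 0 = scan xs"
  by (cases xs) auto

lemma nth_default_tl: "nth_default d (tl xs) i = nth_default d xs (Suc i)"
  by (cases xs) auto

text \<open>One-step simulation. On the side left behind, the written symbol becomes the nearest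
  cell; on the side entered, the nearest cell becomes the scanned one and the rest move up by
  one.\<close>

lemma list_step_Some:
  assumes "represents lc c" "tm_step M c = Some c'"
  obtains lc' where "list_step M lc = Some lc'" "represents lc' c'"
proof -
  obtain q l v r where lc: "lc = (q, l, v, r)" by (metis prod_cases4)
  obtain tape h where c: "c = (q, tape, h)"
    using assms(1) unfolding lc by (cases c) auto
  have v: "tape h = v"
    and l: "\<And>i. tape (h - 1 - int i) = nth_default Blank l i"
    and r: "\<And>i. tape (h + 1 + int i) = nth_default Blank r i"
    using assms(1) unfolding lc c by auto
  obtain q' b d where \<delta>: "delta M q v = Some (q', b, d)"
    and c': "c' = (q', tape(h := b), move_head d h)"
    using assms(2) v unfolding c by (auto split: option.splits)
  show ?thesis
  proof (cases d)
    case Move_Left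
    have "represents (q', tl l, scan l, b # r) c'"
      unfolding c' Move_Left represents.simps move_head.simps
    proof (intro conjI allI refl)
      show "(tape(h := b)) (h - 1) = scan l"
        using l[of 0] by (simp add: nth_default_0_scan)
      show "(tape(h := b)) (h - 1 - 1 - int i) = nth_default Blank (tl l) i" for i
        using l[of "Suc i"] by (simp add: nth_default_tl algebra_simps)
      \<comment> \<open>Index 0 is now the old head cell, holding \<open>b\<close>; an index
        \<open>i > 0\<close> is the old right cell \<open>i - 1\<close>.\<close>
      show "(tape(h := b)) (h - 1 + 1 + int i) = nth_default Blank (b # r) i" for i
        using r[of "i - 1"] by (cases i) (auto simp: algebra_simps)
    qed
    then show ?thesis using that \<delta> Move_Left by (simp add: lc)
  next
    case Move_Right
    have "represents (q', b # l, scan r, tl r) c'"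
      unfolding c' Move_Right represents.simps move_head.simps
    proof (intro conjI allI refl)
      show "(tape(h := b)) (h + 1) = scan r"
        using r[of 0] by (simp add: nth_default_0_scan)
      show "(tape(h := b)) (h + 1 + 1 + int i) = nth_default Blank (tl r) i" for i
        using r[of "Suc i"] by (simp add: nth_default_tl algebra_simps)
      show "(tape(h := b)) (h + 1 - 1 - int i) = nth_default Blank (b # l) i" for i
        using l[of "i - 1"] by (cases i) (auto simp: algebra_simps)
    qed
    then show ?thesis using that \<delta> Move_Right by (simp add: lc)
  qed
qed

text \<open>\<open>scan\<close> and \<open>tl\<close> split the input just as the query does; the
  empty input yields a scanned blank.\<close>

fun initial_list_config :: "'a tm \<Rightarrow> 'a list \<Rightarrow> 'a list_config" where
  "initial_list_config M x = (start M, [], scan (map Letter x), tl (map Letter x))"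

lemma represents_initial: "represents (initial_list_config M x) (initial_config M x)"
  by (cases x) (auto simp: initial_config_def nth_default_def nat_add_distrib)

section \<open>The program of a machine\<close>

text \<open>A unary numeral after a tag makes the names injective; the tag \<open>q\<close> also
  separates them from tape symbols (tag \<open>a\<close>) and from \<open>nil_name\<close>.\<close>

definition state_name :: "nat \<Rightarrow> string" where
  "state_name q = CHR ''q'' # replicate q CHR ''1''"

abbreviation conf_atom :: "trm \<Rightarrow> trm \<Rightarrow> trm \<Rightarrow> trm \<Rightarrow> atom" where
  "conf_atom q l v r \<equiv> Atom ''conf'' [q, l, v, r]"

abbreviation cons_trm :: "trm \<Rightarrow> trm \<Rightarrow> trm" where
  "cons_trm t u \<equiv> Fun cons_name [t, u]"

lemma inj_state_name: "state_name q = state_name q' \<longleftrightarrow> q = q'"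
  unfolding state_name_def by simp

text \<open>The letters come from an arbitrary type; \<open>code\<close> numbers the tape symbols so
  that strings can name them.\<close>

locale coded_machine =
  fixes \<Sigma> :: "'a set" and M :: "'a tm" and code :: "'a tape_symbol \<Rightarrow> nat"
  assumes machine: "turing_machine \<Sigma> M" and inj_code: "inj_on code (tape_alphabet M)"
begin

lemma machine_parts:
  shows finite_states: "finite (states M)"
    and finite_tape_alphabet: "finite (tape_alphabet M)"
    and start_state: "start M \<in> states M"
    and Blank_tape_alphabet: "Blank \<in> tape_alphabet M"
    and Letter_tape_alphabet: "a \<in> \<Sigma> \<Longrightarrow> Letter a \<in> tape_alphabet M"
  using machine unfolding turing_machine_def by (blast+)

definition symbol_name :: "'a tape_symbol \<Rightarrow> string" where
  "symbol_name a = CHR ''a'' # replicate (code a) CHR ''1''"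

abbreviation "state_trm q \<equiv> const (state_name q)"
abbreviation "symbol_trm a \<equiv> const (symbol_name a)"
abbreviation "tape_trm as \<equiv> list_trm (map symbol_trm as)"

fun encode :: "'a list_config \<Rightarrow> atom" where
  "encode (q, l, v, r) = conf_atom (state_trm q) (tape_trm l) (symbol_trm v) (tape_trm r)"

text \<open>The head is a configuration, the body its successor. A transition gets two rules: the
  side entered either has a listed cell, or is exhausted and supplies a blank. \<open>Var 0\<close>
  and \<open>Var 1\<close> are the remaining left and right lists, \<open>Var 2\<close> is the cell
  entered. A rejecting halt gets no rule, so it is underivable.\<close>

definition step_rules :: "nat \<Rightarrow> 'a tape_symbol \<Rightarrow> asp_rule set" where
  "step_rules q a =
     (case delta M q a of
        None \<Rightarrow>
          if q \<in> accepting M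
          then {Rule [conf_atom (state_trm q) (Var 0) (symbol_trm a) (Var 1)] [] []}
          else {}
      | Some (q', b, Move_Left) \<Rightarrow>
          {Rule [conf_atom (state_trm q) (cons_trm (Var 2) (Var 0)) (symbol_trm a) (Var 1)]
             [conf_atom (state_trm q') (Var 0) (Var 2) (cons_trm (symbol_trm b) (Var 1))] [],
           Rule [conf_atom (state_trm q) (list_trm []) (symbol_trm a) (Var 1)]
             [conf_atom (state_trm q') (list_trm []) (symbol_trm Blank)
                (cons_trm (symbol_trm b) (Var 1))] []}
      | Some (q', b, Move_Right) \<Rightarrow>
          {Rule [conf_atom (state_trm q) (Var 0) (symbol_trm a) (cons_trm (Var 2) (Var 1))]
             [conf_atom (state_trm q') (cons_trm (symbol_trm b) (Var 0)) (Var 2) (Var 1)] [],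
           Rule [conf_atom (state_trm q) (Var 0) (symbol_trm a) (list_trm [])]
             [conf_atom (state_trm q') (cons_trm (symbol_trm b) (Var 0)) (symbol_trm Blank)
                (list_trm [])] []})"

text \<open>These rules say nothing about configurations; they make all constants and the list
  constructors occur in the program, whatever the machine is.\<close>

definition symbol_rule :: "nat \<Rightarrow> 'a tape_symbol \<Rightarrow> asp_rule" where
  "symbol_rule q a =
     Rule [Atom ''symbols'' []]
       [conf_atom (state_trm q) (list_trm []) (symbol_trm a) (list_trm [list_trm []])] []"

definition program :: "asp_rule set" where
  "program = (\<Union>q\<in>states M. \<Union>a\<in>tape_alphabet M. insert (symbol_rule q a) (step_rules q a))"

section \<open>Syntactic properties of the program\<close>

lemma definite_step_rules:
  "r \<in> step_rules q a \<Longrightarrow> (\<exists>h. head r = [h]) \<and> neg r = []"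
  unfolding step_rules_def
  by (auto split: option.split_asm move.split_asm if_split_asm)

lemma definite_program: "definite program"
  using definite_step_rules unfolding definite_def program_def by (auto simp: symbol_rule_def)

lemma finite_step_rules: "finite (step_rules q a)"
  unfolding step_rules_def by (simp split: option.split prod.split move.split)

lemma finite_program: "finite program"
  using finite_states finite_tape_alphabet finite_step_rules unfolding program_def by simp

lemma symbols_in_program:
  assumes "q \<in> states M" "a \<in> tape_alphabet M"
  shows "(''conf'', 4) \<in> preds program"
    and "{(state_name q, 0), (symbol_name a, 0), (nil_name, 0), (cons_name, 2)} \<subseteq> funs program"
proof -
  have "symbol_rule q a \<in> program" using assms unfolding program_def by blast
  then have "atom_pred b \<in> preds program \<and> atom_funs b \<subseteq> funs program"
    if "b \<in> atoms (symbol_rule q a)" for b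
    using that unfolding preds_def funs_def by blast
  \<comment> \<open>The body atom of \<open>symbol_rule\<close> contains every symbol claimed;
    \<open>list_trm [list_trm []]\<close> contributes the list constructor.\<close>
  from this[of "conf_atom (state_trm q) (list_trm []) (symbol_trm a) (list_trm [list_trm []])"]
  show "(''conf'', 4) \<in> preds program"
    and "{(state_name q, 0), (symbol_name a, 0), (nil_name, 0), (cons_name, 2)} \<subseteq> funs program"
    by (auto simp: symbol_rule_def atoms_def eval_nat_numeral)
qed

section \<open>Valid configurations and their ground atoms\<close>

text \<open>The invariant of a run: it makes the symbol names injective and all terms of the code
  ground.\<close>

fun valid :: "'a list_config \<Rightarrow> bool" where
  "valid (q, l, v, r) \<longleftrightarrow> q \<in> states M \<and> set (v # l @ r) \<subseteq> tape_alphabet M"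

lemma inj_symbol_name:
  "a \<in> tape_alphabet M \<Longrightarrow> b \<in> tape_alphabet M \<Longrightarrow> symbol_name a = symbol_name b \<longleftrightarrow> a = b"
  using inj_code unfolding symbol_name_def inj_on_def by simp metis

lemma delta_closed:
  assumes "q \<in> states M" "a \<in> tape_alphabet M" "delta M q a = Some (q', b, d)"
  shows "q' \<in> states M" "b \<in> tape_alphabet M"
  using machine assms unfolding turing_machine_def by blast+

lemma scan_tape_alphabet: "set xs \<subseteq> tape_alphabet M \<Longrightarrow> scan xs \<in> tape_alphabet M"
  using Blank_tape_alphabet by (cases xs) auto

lemma valid_list_step:
  assumes "valid lc" "list_step M lc = Some lc'"
  shows "valid lc'"
proof -
  obtain q l v r where lc: "lc = (q, l, v, r)" by (metis prod_cases4)
  obtain q' b d where \<delta>: "delta M q v = Some (q', b, d)"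
    using assms(2) unfolding lc by (auto split: option.splits)
  have "q' \<in> states M" "b \<in> tape_alphabet M"
    using delta_closed[OF _ _ \<delta>] assms(1) unfolding lc by auto
  moreover have "set (tl xs) \<subseteq> tape_alphabet M" if "set xs \<subseteq> tape_alphabet M" for xs
    using that by (cases xs) auto
  ultimately show ?thesis
    using assms \<delta> scan_tape_alphabet unfolding lc by (cases d) auto
qed

lemma valid_initial:
  assumes "x \<in> lists \<Sigma>"
  shows "valid (initial_list_config M x)"
  using assms start_state Blank_tape_alphabet Letter_tape_alphabet by (cases x) auto

lemma symbol_ground: "a \<in> tape_alphabet M \<Longrightarrow> symbol_trm a \<in> ground_terms (funs program)"
  using symbols_in_program(2)[OF start_state, of a] by (intro ground_terms.intros) auto

lemma state_ground: "q \<in> states M \<Longrightarrow> state_trm q \<in> ground_terms (funs program)"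
  using symbols_in_program(2)[OF _ Blank_tape_alphabet] by (intro ground_terms.intros) auto

lemma tape_ground: "set as \<subseteq> tape_alphabet M \<Longrightarrow> tape_trm as \<in> ground_terms (funs program)"
proof (induction as)
  case Nil
  then show ?case
    using symbols_in_program(2)[OF start_state Blank_tape_alphabet]
    by (auto intro: ground_terms.intros)
next
  case (Cons a as)
  have "(cons_name, length [symbol_trm a, tape_trm as]) \<in> funs program"
    using symbols_in_program(2)[OF start_state Blank_tape_alphabet]
    by (simp add: numeral_2_eq_2)
  then have "cons_trm (symbol_trm a) (tape_trm as) \<in> ground_terms (funs program)"
    by (rule ground_terms.intros) (use Cons symbol_ground in auto)
  then show ?case by simp
qed

lemma encode_herbrand_base: "valid lc \<Longrightarrow> encode lc \<in> herbrand_base program"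
  using symbols_in_program(1)[OF start_state Blank_tape_alphabet]
    symbol_ground state_ground tape_ground
  by (cases lc) (auto simp: herbrand_base_def eval_nat_numeral)

section \<open>Ground rules whose head is a given configuration\<close>

lemma step_rules_Ground:
  assumes "q \<in> states M" "a \<in> tape_alphabet M" "r \<in> step_rules q a"
    and "\<And>v. v \<in> rule_vars r \<Longrightarrow> \<sigma> v \<in> ground_terms (funs program)"
  shows "subst_rule \<sigma> r \<in> Ground program"
  using assms unfolding Ground_def program_def by blast

text \<open>State and scanned symbol are constants in the head of every step rule, untouched by
  substitution; injectivity of names recovers the pair \<open>(q, v)\<close>.\<close>

lemma Ground_head_encode:
  assumes "valid (q, l, v, r)" "R \<in> Ground program" "encode (q, l, v, r) \<in> H R"
  obtains \<sigma> R0 where "R0 \<in> step_rules q v" "R = subst_rule \<sigma> R0"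
proof -
  obtain \<sigma> R0 where "R0 \<in> program" and R: "R = subst_rule \<sigma> R0"
    using assms(2) unfolding Ground_def by auto
  then obtain q' a where qa: "q' \<in> states M" "a \<in> tape_alphabet M"
    "R0 \<in> insert (symbol_rule q' a) (step_rules q' a)"
    unfolding program_def by auto
  have head: "encode (q, l, v, r) \<in> subst_atom \<sigma> ` H R0"
    using assms(3) unfolding R subst_rule_def by simp
  then have "R0 \<noteq> symbol_rule q' a" by (auto simp: symbol_rule_def)
  with qa have R0: "R0 \<in> step_rules q' a" by simp
  then have "state_name q = state_name q'" "symbol_name v = symbol_name a"
    using head unfolding step_rules_def
    by (auto split: option.splits move.splits if_splits)
  then have "q = q'" "v = a"
    using inj_state_name inj_symbol_name qa(2) assms(1) by auto
  with R0 R show ?thesis using that by blast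
qed

lemma Ground_rules_halted:
  assumes "valid (q, l, v, r)" "delta M q v = None" "R \<in> Ground program"
    "encode (q, l, v, r) \<in> H R"
  shows "q \<in> accepting M \<and> R = Rule [encode (q, l, v, r)] [] []"
proof -
  obtain \<sigma> R0 where "R0 \<in> step_rules q v" "R = subst_rule \<sigma> R0"
    by (rule Ground_head_encode[OF assms(1,3,4)])
  with assms(2,4) show ?thesis
    by (auto simp: step_rules_def subst_rule_def split: if_splits)
qed

text \<open>Determinism of the program: \<open>delta\<close> fixes the pair of rules, the shape of
  the list on the side entered picks one of them, and matching the head fixes every variable of the
  body.\<close>

lemma Ground_rules_step:
  assumes "valid lc" "list_step M lc = Some lc'" "R \<in> Ground program" "encode lc \<in> H R"
  shows "R = Rule [encode lc] [encode lc'] []"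
proof -
  obtain q l v r where lc: "lc = (q, l, v, r)" by (metis prod_cases4)
  obtain \<sigma> R0 where "R0 \<in> step_rules q v" "R = subst_rule \<sigma> R0"
    by (rule Ground_head_encode[OF assms(1,3,4)[unfolded lc]])
  \<comment> \<open>Reorients the equations from matching a variable with a constant, so that
    \<open>\<sigma> i\<close> is what gets replaced.\<close>
  moreover have "const c = \<sigma> i \<longleftrightarrow> \<sigma> i = const c" for c i by (rule eq_commute)
  ultimately show ?thesis
    using assms(2,4) unfolding lc
    by (cases l; cases r)
      (auto simp: step_rules_def subst_rule_def nil_name_def cons_name_def
        split: option.splits move.splits)
qed

lemma Ground_halted:
  assumes "valid (q, l, v, r)" "delta M q v = None" "q \<in> accepting M"
  shows "Rule [encode (q, l, v, r)] [] [] \<in> Ground program"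
proof -
  let ?R = "Rule [conf_atom (state_trm q) (Var 0) (symbol_trm v) (Var 1)] [] []"
  let ?\<sigma> = "\<lambda>i::nat. if i = 0 then tape_trm l else tape_trm r"
  have "subst_rule ?\<sigma> ?R \<in> Ground program"
    using assms tape_ground by (intro step_rules_Ground[of q v]) (auto simp: step_rules_def)
  then show ?thesis by (simp add: subst_rule_def)
qed

text \<open>Complements \<open>Ground_rules_step\<close>: the only possible rule does occur, because
  validity makes the required substitution ground.\<close>

lemma Ground_step:
  assumes "valid lc" "list_step M lc = Some lc'"
  shows "Rule [encode lc] [encode lc'] [] \<in> Ground program"
proof -
  obtain q l v r where lc: "lc = (q, l, v, r)" by (metis prod_cases4)
  obtain q' b d where \<delta>: "delta M q v = Some (q', b, d)"
    using assms(2) unfolding lc by (auto split: option.splits)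
  \<comment> \<open>\<open>Var 0\<close> and \<open>Var 1\<close> receive the lists, the one on the
    side entered without its first cell; \<open>u\<close> is the entered cell for
    \<open>Var 2\<close>. In the exhausted cases below \<open>Var 2\<close> does not occur, and the
    blank is a ground filler.\<close>
  let ?\<sigma> = "\<lambda>u (i::nat). if i = 0 then tape_trm (if d = Move_Left then tl l else l)
    else if i = 1 then tape_trm (if d = Move_Right then tl r else r) else u"
  have in_Ground: "subst_rule (?\<sigma> (symbol_trm a)) R \<in> Ground program"
    if "R \<in> step_rules q v" "a \<in> tape_alphabet M" for R a
  proof (rule step_rules_Ground)
    have "set (tl xs) \<subseteq> tape_alphabet M" if "set xs \<subseteq> tape_alphabet M" for xs
      using that by (cases xs) auto
    then show "?\<sigma> (symbol_trm a) i \<in> ground_terms (funs program)" for i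
      using assms(1) tape_ground symbol_ground that(2) unfolding lc by auto
  qed (use assms(1) that in \<open>auto simp: lc\<close>)
  show ?thesis
  proof (cases d)
    case Move_Left
    show ?thesis
    proof (cases l)
      case Nil
      let ?R = "Rule [conf_atom (state_trm q) (list_trm []) (symbol_trm v) (Var 1)]
             [conf_atom (state_trm q') (list_trm []) (symbol_trm Blank)
                (cons_trm (symbol_trm b) (Var 1))] []"
      have "subst_rule (?\<sigma> (symbol_trm Blank)) ?R \<in> Ground program"
        using \<delta> Move_Left Blank_tape_alphabet by (intro in_Ground) (auto simp: step_rules_def)
      then show ?thesis using assms(2)[symmetric] \<delta> Move_Left Nil by (simp add: lc subst_rule_def)
    next
      case (Cons a l')
      let ?R = "Rule [conf_atom (state_trm q) (cons_trm (Var 2) (Var 0)) (symbol_trm v) (Var 1)]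
             [conf_atom (state_trm q') (Var 0) (Var 2) (cons_trm (symbol_trm b) (Var 1))] []"
      have "subst_rule (?\<sigma> (symbol_trm a)) ?R \<in> Ground program"
        using \<delta> Move_Left assms(1) Cons by (intro in_Ground) (auto simp: step_rules_def lc)
      then show ?thesis using assms(2)[symmetric] \<delta> Move_Left Cons by (simp add: lc subst_rule_def)
    qed
  next
    case Move_Right
    show ?thesis
    proof (cases r)
      case Nil
      let ?R = "Rule [conf_atom (state_trm q) (Var 0) (symbol_trm v) (list_trm [])]
             [conf_atom (state_trm q') (cons_trm (symbol_trm b) (Var 0)) (symbol_trm Blank)
                (list_trm [])] []"
      have "subst_rule (?\<sigma> (symbol_trm Blank)) ?R \<in> Ground program"
        using \<delta> Move_Right Blank_tape_alphabet by (intro in_Ground) (auto simp: step_rules_def)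
      then show ?thesis using assms(2)[symmetric] \<delta> Move_Right Nil by (simp add: lc subst_rule_def)
    next
      case (Cons a r')
      let ?R = "Rule [conf_atom (state_trm q) (Var 0) (symbol_trm v) (cons_trm (Var 2) (Var 1))]
             [conf_atom (state_trm q') (cons_trm (symbol_trm b) (Var 0)) (Var 2) (Var 1)] []"
      have "subst_rule (?\<sigma> (symbol_trm a)) ?R \<in> Ground program"
        using \<delta> Move_Right assms(1) Cons by (intro in_Ground) (auto simp: step_rules_def lc)
      then show ?thesis using assms(2)[symmetric] \<delta> Move_Right Cons by (simp add: lc subst_rule_def)
    qed
  qed
qed

section \<open>Relevance and derivability along a run\<close>

text \<open>The only ground rule that can have this head is a fact, present exactly for accepting
  states, so no further atom becomes relevant.\<close>

lemma halted_entailment: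
  assumes "valid (q, l, v, r)" "delta M q v = None"
  shows "finitely_recursive program (encode (q, l, v, r))"
    and "encode (q, l, v, r) \<in> least_model program \<longleftrightarrow> q \<in> accepting M"
proof -
  have "relevant program (encode (q, l, v, r)) \<subseteq> {encode (q, l, v, r)}"
    by (rule relevant_subset)
      (auto simp: atoms_def simp del: encode.simps dest!: Ground_rules_halted[OF assms])
  then show "finitely_recursive program (encode (q, l, v, r))"
    unfolding finitely_recursive_def by (rule finite_subset) simp
  show "encode (q, l, v, r) \<in> least_model program \<longleftrightarrow> q \<in> accepting M"
  proof
    assume "encode (q, l, v, r) \<in> least_model program"
    then obtain R where "R \<in> Ground program" "H R = {encode (q, l, v, r)}"
      by (rule least_modelE)
    then show "q \<in> accepting M" using Ground_rules_halted[OF assms, of R] by simp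
  next
    assume "q \<in> accepting M"
    from Ground_halted[OF assms this] show "encode (q, l, v, r) \<in> least_model program"
      by (rule least_model.intros) auto
  qed
qed

text \<open>Exactly one ground rule has this head, and its body is the successor: relevance gains at
  most one atom, and derivability passes both ways.\<close>

lemma step_entailment:
  assumes "valid lc" "list_step M lc = Some lc'"
  shows "finitely_recursive program (encode lc') \<Longrightarrow> finitely_recursive program (encode lc)"
    and "encode lc \<in> least_model program \<longleftrightarrow> encode lc' \<in> least_model program"
proof -
  have "relevant program (encode lc) \<subseteq> insert (encode lc) (relevant program (encode lc'))"
  proof (rule relevant_subset)
    fix a R
    assume a: "a \<in> insert (encode lc) (relevant program (encode lc'))"
      and R: "R \<in> Ground program" "a \<in> H R"
    show "atoms R \<subseteq> insert (encode lc) (relevant program (encode lc'))"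
    proof (cases "a = encode lc")
      case True
      with Ground_rules_step[OF assms R(1)] R(2) show ?thesis
        by (auto simp: atoms_def relevant.query)
    next
      case False
      with a R show ?thesis by (auto intro: relevant.rule_atom)
    qed
  qed simp
  then show "finitely_recursive program (encode lc)" if "finitely_recursive program (encode lc')"
    using that unfolding finitely_recursive_def by (auto intro: finite_subset)
  show "encode lc \<in> least_model program \<longleftrightarrow> encode lc' \<in> least_model program"
  proof
    assume "encode lc \<in> least_model program"
    then obtain R where "R \<in> Ground program" "H R = {encode lc}" "Bpos R \<subseteq> least_model program"
      by (rule least_modelE)
    then show "encode lc' \<in> least_model program" using Ground_rules_step[OF assms, of R] by simp
  next
    assume "encode lc' \<in> least_model program"
    with Ground_step[OF assms] show "encode lc \<in> least_model program"
      by (auto intro: least_model.intros)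
  qed
qed

text \<open>Induction from the halting configuration back to \<open>c\<close>, with
  \<open>lc\<close> general because each step changes the code. Finiteness of the run is what makes
  the relevant set finite.\<close>

lemma run_entailment:
  assumes "(\<lambda>c c'. tm_step M c = Some c')\<^sup>*\<^sup>* c (q', tape', h')" "tm_step M (q', tape', h') = None"
    and "valid lc" "represents lc c"
  shows "finitely_recursive program (encode lc) \<and>
    (encode lc \<in> least_model program \<longleftrightarrow> q' \<in> accepting M)"
  using assms(1,3,4)
proof (induction arbitrary: lc rule: converse_rtranclp_induct)
  case base
  obtain q l v r where lc: "lc = (q, l, v, r)" by (metis prod_cases4)
  \<comment> \<open>State and scanned symbol agree with the represented configuration, so
    \<open>delta\<close> is undefined for the code as well.\<close>
  have "q = q'" "tape' h' = v" using base unfolding lc by auto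
  with base assms(2) halted_entailment[of q l v r] show ?case
    unfolding lc by (auto split: option.splits)
next
  case (step c c')
  obtain lc' where lc': "list_step M lc = Some lc'" "represents lc' c'"
    using list_step_Some step by metis
  with step.IH[of lc'] step_entailment[OF step.prems(1) lc'(1)] valid_list_step[OF step.prems(1)]
  show ?case by blast
qed

lemma conf_query_initial:
  "conf_query ''conf'' (state_name (start M)) (\<lambda>a. symbol_name (Letter a)) (symbol_name Blank) x
    = encode (initial_list_config M x)"
  by (cases x) (auto simp: comp_def)

lemma initial_entailment:
  assumes "x \<in> lists \<Sigma>" "tm_halts M x"
  shows "finitely_recursive program (encode (initial_list_config M x))"
    and "encode (initial_list_config M x) \<in> least_model program \<longleftrightarrow> tm_accepts M x"
proof -
  \<comment> \<open>Holding for every halting configuration, this serves both the one given by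
    \<open>tm_halts\<close> and any witness of \<open>tm_accepts\<close>.\<close>
  have run: "finitely_recursive program (encode (initial_list_config M x)) \<and>
    (encode (initial_list_config M x) \<in> least_model program \<longleftrightarrow> q \<in> accepting M)"
    if "halts_in M x (q, tape, h)" for q tape h
    using that run_entailment valid_initial[OF assms(1)] represents_initial
    unfolding halts_in_def by blast
  obtain q tape h where "halts_in M x (q, tape, h)"
    using assms(2) unfolding tm_halts_def by (metis prod_cases3)
  with run show "finitely_recursive program (encode (initial_list_config M x))"
    and "encode (initial_list_config M x) \<in> least_model program \<longleftrightarrow> tm_accepts M x"
    unfolding tm_accepts_def by blast+
qed

end

text \<open>The clauses on names make the map from strings to queries injective; membership in the
  Herbrand base makes each query a ground atom over the symbols of \<open>P\<close>.\<close>

theorem theorem7: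
  fixes \<Sigma> :: "'a set" and L :: "'a list set"
  assumes "finite \<Sigma>"
    and "computable_language \<Sigma> L"
  shows "\<exists>P conf s_i letter blank.
    asp_fs_program P \<and>
    (conf, 4) \<in> preds P \<and>
    (s_i, 0) \<in> funs P \<and> (blank, 0) \<in> funs P \<and> (\<forall>a\<in>\<Sigma>. (letter a, 0) \<in> funs P) \<and>
    inj_on letter \<Sigma> \<and> distinct [s_i, blank, nil_name] \<and>
    {s_i, blank, nil_name} \<inter> letter ` \<Sigma> = {} \<and>
    (\<forall>x\<in>lists \<Sigma>. let Q = conf_query conf s_i letter blank x in
       Q \<in> herbrand_base P \<and>
       finitely_recursive P Q \<and>
       (cautiously_entails P Q \<longleftrightarrow> bravely_entails P Q) \<and>
       (bravely_entails P Q \<longleftrightarrow> x \<in> L))"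
proof -
  obtain M where M: "turing_machine \<Sigma> M"
    and L: "\<And>x. x \<in> lists \<Sigma> \<Longrightarrow> tm_halts M x \<and> (tm_accepts M x \<longleftrightarrow> x \<in> L)"
    using assms(2) unfolding computable_language_def by blast
  have "finite (tape_alphabet M)" using M unfolding turing_machine_def by blast
  then obtain code :: "'a tape_symbol \<Rightarrow> nat" where "inj_on code (tape_alphabet M)"
    using finite_imp_inj_to_nat_seg by metis
  with M interpret coded_machine \<Sigma> M code by unfold_locales
  \<comment> \<open>The three kinds of names differ in their first characters.\<close>
  have names: "state_name q \<noteq> symbol_name a" "state_name q \<noteq> nil_name" "symbol_name a \<noteq> nil_name"
    for q a
    unfolding state_name_def symbol_name_def nil_name_def by auto
  show ?thesis
    unfolding Let_def
  proof (intro exI conjI ballI)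
    show "asp_fs_program program"
      using finite_program definite_program by (rule asp_fs_program_definite)
    show "(''conf'', 4) \<in> preds program"
      using symbols_in_program(1) start_state Blank_tape_alphabet by blast
    show "(state_name (start M), 0) \<in> funs program" "(symbol_name Blank, 0) \<in> funs program"
      using symbols_in_program(2) start_state Blank_tape_alphabet by blast+
    show "(symbol_name (Letter a), 0) \<in> funs program" if "a \<in> \<Sigma>" for a
      using symbols_in_program(2) start_state Letter_tape_alphabet[OF that] by blast
    show "inj_on (\<lambda>a. symbol_name (Letter a)) \<Sigma>"
      using Letter_tape_alphabet by (auto simp: inj_on_def inj_symbol_name)
    show "distinct [state_name (start M), symbol_name Blank, nil_name]"
      using names by simp
    show "{state_name (start M), symbol_name Blank, nil_name} \<inter> (\<lambda>a. symbol_name (Letter a)) ` \<Sigma> = {}"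
      using names(1,3) names(3)[symmetric]
      by (auto simp: inj_symbol_name Blank_tape_alphabet Letter_tape_alphabet)
  next
    fix x assume x: "x \<in> lists \<Sigma>"
    let ?Q = "conf_query ''conf'' (state_name (start M)) (\<lambda>a. symbol_name (Letter a))
      (symbol_name Blank) x"
    show "?Q \<in> herbrand_base program"
      unfolding conf_query_initial using x valid_initial encode_herbrand_base by blast
    show "finitely_recursive program ?Q"
      unfolding conf_query_initial using initial_entailment x L by blast
    show "cautiously_entails program ?Q \<longleftrightarrow> bravely_entails program ?Q"
      unfolding entails_definite[OF definite_program] by (rule refl)
    show "bravely_entails program ?Q \<longleftrightarrow> x \<in> L"
      unfolding entails_definite[OF definite_program] conf_query_initial
      using initial_entailment x L by blast
  qed
qed

end
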